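(* Consider a non-degenerate helicoidal surface in $\mathbf{E}_1^3$ (axis $L$, pitch $h\neq 0$) with constant mean curvature $H$ whose generating curve is the graph of a polynomial $f(s)=\sum_{n=0}^m a_n s^n$. Then $m\le 1$, that is, the generating curve is a straight line. Moreover, after a rigid motion of $\mathbf{E}_1^3$: 1. If the axis is timelike, $L=\langle(0,0,1)\rangle$, the surface is one of: the helicoid of first kind (with $H=0$); the surface $X(s,t)=(s\cos t,\ s\sin t,\ \pm s+a_0+ht)$, $a_0\in\mathbb{R}$, with $|H|=1/|h|$; or the Lorentzian cylinder $x^2+y^2=r^2$ $(r>0)$ with $|H|=1/(2r)$. 2. If the axis is spacelike, $L=\langle(1,0,0)\rangle$, then $H=0$, and the surface is the helicoid of second kind, the helicoid of third kind, or the surface parametrized by $X(s,t)=(ht,\ (\pm s+a_0)\sinh t+s\cosh t,\ (\pm s+a_0)\cosh t+s\sinh t)$ with $a_0\neq 0$. 3. If the axis is lightlike, $L=\langle(1,0,1)\rangle$, then $H=0$ and the surface is Cayley's surface or the parabolic null cylinder.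
   Context: $\mathbf{E}_1^3$ is $\mathbb{R}^3$ with the metric $\langle(x,y,z),(x',y',z')\rangle=xx'+yy'-zz'$. A vector $v$ is spacelike if $\langle v,v\rangle>0$ or $v=0$, timelike if $\langle v,v\rangle<0$, lightlike if $\langle v,v\rangle=0$, $v\ne0$; a line is called timelike, spacelike or lightlike according to its direction vector. Rigid motions are isometries of $\mathbf{E}_1^3$. Helicoidal motions. A helicoidal motion group $G_{L,h}=\{\phi_t : t\in\mathbb{R}\}$ with axis $L$ and pitch $h\neq0$ is, after a change of coordinates by a rigid motion, one of the following, and coordinates are always chosen so: - $L=\langle(0,0,1)\rangle$ timelike: $\phi_t(a,b,c)=(a\cos t-b\sin t,\ a\sin t+b\cos t,\ c+ht)$. - $L=\langle(1,0,0)\rangle$ spacelike: $\phi_t(a,b,c)=(a+ht,\ b\cosh t+c\sinh t,\ b\sinh t+c\cosh t)$. - $L=\langle(1,0,1)\rangle$ lightlike: $\phi_t(a,b,c)=\big((1-\tfrac{t^2}{2})a+tb+\tfrac{t^2}{2}c,\ -ta+b+tc,\ -\tfrac{t^2}{2}a+tb+(1+\tfrac{t^2}{2})c\big)+h\big(\tfrac{t^3}{3}-t,\ t^2,\ \tfrac{t^3}{3}+t\big)$. Helicoidal surface and generating curve. A helicoidal surface is one invariant under some $G_{L,h}$, $h\ne0$; it is parametrized by $X(s,t)=\phi_t(\gamma(s))$, $s\in I$ (an open interval), $t\in\mathbb{R}$, where the generating curve $\gamma$ is a planar curve contained in the plane $y=0$ (timelike axis), $x=0$ (spacelike axis), $x=z$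 (lightlike axis). "$\gamma$ is the graph of a polynomial $f$" means: $\gamma(s)=(s,0,f(s))$ (timelike axis), $\gamma(s)=(0,s,f(s))$ (spacelike axis), $\gamma(s)=(f(s),s,f(s))$ (lightlike axis), with $a_m\neq 0$ if $m\ge1$. The straight lines that are not graphs of this form, namely $\gamma(s)=(r,0,s)$ with $r>0$, $\gamma(s)=(0,b,s)$, $\gamma(s)=(s,b,s)$ respectively, are also admitted (and counted as degree $\le 1$). Surfaces are identified locally: "the surface is $S$" means it is an open part of $S$. Curvature. The surface is non-degenerate: its induced metric is everywhere Riemannian (spacelike surface) or everywhere Lorentzian (timelike surface). Let $N$ be a (local) unit normal, $\epsilon=\langle N,N\rangle$ ($\epsilon=-1$ if spacelike, $\epsilon=1$ if timelike), and $A=-dN$. The mean curvature is $H=\frac{\epsilon}{2}\operatorname{trace}(A)$. Named surfaces (all with parameters $s,t$, pitch $h$): - helicoid of first kind: $(s\cos t,\ s\sin t,\ ht)$; - helicoid of second kind: $(ht,\ s\cosh t,\ s\sinh t)$; - helicoid of third kind: $(ht,\ s\sinh t,\ s\cosh t)$; - Cayley's surface: $\big(st+h(\tfrac{t^3}{3}-t),\ s+ht^2,\ st+h(\tfrac{t^3}{3}+t)\big)$; - parabolic null cylinder: $\big(s+bt+h(\tfrac{t^3}{3}-t),\ b+ht^2,\ s+bt+h(\tfrac{t^3}{3}+t)\big)$, $b\in\mathbb{R}$. *)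

theory Defs
  imports "HOL-Analysis.Analysis" "HOL-Computational_Algebra.Polynomial"
begin

type_synonym vec3 = "real \<times> real \<times> real"

fun lorentz :: "vec3 \<Rightarrow> vec3 \<Rightarrow> real" where
  "lorentz (x, y, z) (x', y', z') = x * x' + y * y' - z * z'"

definition rigid_motion :: "(vec3 \<Rightarrow> vec3) \<Rightarrow> bool" where
  "rigid_motion \<Phi> \<longleftrightarrow>
     (\<exists>L p. linear L \<and> (\<forall>u v. lorentz (L u) (L v) = lorentz u v) \<and> \<Phi> = (\<lambda>x. L x + p))"


section \<open>Helicoidal motions and surfaces\<close>

text \<open>The three causal types of the axis, in normalised coordinates: the axis is spanned by
  \<open>(0,0,1)\<close>, \<open>(1,0,0)\<close> and \<open>(1,0,1)\<close> respectively.\<close>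

datatype axis = Timelike | Spacelike | Lightlike

fun helicoidal_motion :: "axis \<Rightarrow> real \<Rightarrow> real \<Rightarrow> vec3 \<Rightarrow> vec3" where
  "helicoidal_motion Timelike h t (a, b, c) =
     (a * cos t - b * sin t, a * sin t + b * cos t, c + h * t)"
| "helicoidal_motion Spacelike h t (a, b, c) =
     (a + h * t, b * cosh t + c * sinh t, b * sinh t + c * cosh t)"
| "helicoidal_motion Lightlike h t (a, b, c) =
     ((1 - t\<^sup>2 / 2) * a + t * b + t\<^sup>2 / 2 * c + h * (t ^ 3 / 3 - t),
      - t * a + b + t * c + h * t\<^sup>2,
      - (t\<^sup>2 / 2) * a + t * b + (1 + t\<^sup>2 / 2) * c + h * (t ^ 3 / 3 + t))"

definition helicoidal_surface ::
    "axis \<Rightarrow> real \<Rightarrow> (real \<Rightarrow> vec3) \<Rightarrow> real \<times> real \<Rightarrow> vec3" where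
  "helicoidal_surface K h \<gamma> = (\<lambda>(s, t). helicoidal_motion K h t (\<gamma> s))"

fun graph_curve :: "axis \<Rightarrow> real poly \<Rightarrow> real \<Rightarrow> vec3" where
  "graph_curve Timelike f s = (s, 0, poly f s)"
| "graph_curve Spacelike f s = (0, s, poly f s)"
| "graph_curve Lightlike f s = (poly f s, s, poly f s)"

text \<open>\<open>generating_curve K m \<gamma>\<close>: \<open>\<gamma>\<close> is the graph of a real polynomial of degree \<open>m\<close> in the
  coordinate plane belonging to \<open>K\<close>, or one of the straight lines of that plane which are not such
  graphs; the latter are counted as having degree \<open>1\<close>.\<close>

inductive generating_curve :: "axis \<Rightarrow> nat \<Rightarrow> (real \<Rightarrow> vec3) \<Rightarrow> bool" where
  graph: "generating_curve K (degree f) (graph_curve K f)"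
| line_timelike: "r > 0 \<Longrightarrow> generating_curve Timelike 1 (\<lambda>s. (r, 0, s))"
| line_spacelike: "generating_curve Spacelike 1 (\<lambda>s. (0, b, s))"
| line_lightlike: "generating_curve Lightlike 1 (\<lambda>s. (s, b, s))"


section \<open>Induced metric and mean curvature of a parametrised surface\<close>

definition induced_metric ::
    "(real \<times> real \<Rightarrow> vec3) \<Rightarrow> real \<times> real \<Rightarrow> real \<times> real \<Rightarrow> real \<times> real \<Rightarrow> real" where
  "induced_metric X p v w =
     lorentz (frechet_derivative X (at p) v) (frechet_derivative X (at p) w)"

definition riemannian_at :: "(real \<times> real \<Rightarrow> vec3) \<Rightarrow> real \<times> real \<Rightarrow> bool" where
  "riemannian_at X p \<longleftrightarrow> (\<forall>v. v \<noteq> 0 \<longrightarrow> induced_metric X p v v > 0)"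

text \<open>Signature \<open>(1,1)\<close>; in dimension two non-degeneracy is then automatic.\<close>

definition lorentzian_at :: "(real \<times> real \<Rightarrow> vec3) \<Rightarrow> real \<times> real \<Rightarrow> bool" where
  "lorentzian_at X p \<longleftrightarrow>
     (\<exists>v. induced_metric X p v v > 0) \<and> (\<exists>w. induced_metric X p w w < 0)"

definition nondegenerate_surface ::
    "(real \<times> real \<Rightarrow> vec3) \<Rightarrow> (real \<times> real) set \<Rightarrow> bool" where
  "nondegenerate_surface X U \<longleftrightarrow>
     (\<forall>p\<in>U. riemannian_at X p) \<or> (\<forall>p\<in>U. lorentzian_at X p)"

definition unit_normal_field ::
    "(real \<times> real \<Rightarrow> vec3) \<Rightarrow> (real \<times> real) set \<Rightarrow> (real \<times> real \<Rightarrow> vec3) \<Rightarrow> bool" where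
  "unit_normal_field X U N \<longleftrightarrow>
     (\<forall>p\<in>U. N differentiable (at p) \<and> \<bar>lorentz (N p) (N p)\<bar> = 1 \<and>
        (\<forall>v. lorentz (N p) (frechet_derivative X (at p) v) = 0))"

text \<open>The shape operator \<open>A = - dN\<close>, read as an endomorphism of the parameter plane through the
  isomorphism \<open>dX\<close> onto the tangent plane.\<close>

definition shape_operator_at ::
    "(real \<times> real \<Rightarrow> vec3) \<Rightarrow> (real \<times> real \<Rightarrow> vec3) \<Rightarrow> real \<times> real
      \<Rightarrow> (real \<times> real \<Rightarrow> real \<times> real) \<Rightarrow> bool" where
  "shape_operator_at X N p A \<longleftrightarrow>
     linear A \<and>
     (\<forall>v. frechet_derivative X (at p) (A v) = - frechet_derivative N (at p) v)"

definition endo_trace :: "('a::euclidean_space \<Rightarrow> 'a) \<Rightarrow> real" where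
  "endo_trace A = (\<Sum>b\<in>Basis. A b \<bullet> b)"

text \<open>\<open>lorentz (N p) (N p)\<close> is the sign \<open>\<epsilon>\<close> in \<open>H = (\<epsilon> / 2) trace A\<close>. On a non-degenerate surface
  the shape operator, hence \<open>H\<close>, exists and is unique.\<close>

definition has_mean_curvature_at ::
    "(real \<times> real \<Rightarrow> vec3) \<Rightarrow> (real \<times> real \<Rightarrow> vec3) \<Rightarrow> real \<times> real \<Rightarrow> real \<Rightarrow> bool" where
  "has_mean_curvature_at X N p H \<longleftrightarrow>
     (\<exists>A. shape_operator_at X N p A \<and> H = lorentz (N p) (N p) / 2 * endo_trace A)"


section \<open>Open parts of surfaces up to rigid motion\<close>

text \<open>Being an open part of a parametrised surface \<open>Y\<close> is expressed by a diffeomorphic change of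
  parameters and not by relative openness of the image, since \<open>Y\<close> may have self-intersections.\<close>

definition open_part_of ::
    "(real \<times> real \<Rightarrow> vec3) \<Rightarrow> (real \<times> real) set \<Rightarrow> (real \<times> real \<Rightarrow> vec3) \<Rightarrow> bool" where
  "open_part_of X U Y \<longleftrightarrow>
     (\<exists>W \<psi> \<theta>. open W \<and> homeomorphism U W \<psi> \<theta> \<and>
        \<psi> differentiable_on U \<and> \<theta> differentiable_on W \<and> (\<forall>p\<in>U. X p = Y (\<psi> p)))"

definition congruent_to_part_of ::
    "(real \<times> real \<Rightarrow> vec3) \<Rightarrow> (real \<times> real) set \<Rightarrow> (real \<times> real \<Rightarrow> vec3) \<Rightarrow> bool" where
  "congruent_to_part_of X U Y \<longleftrightarrow> (\<exists>\<Phi>. rigid_motion \<Phi> \<and> open_part_of (\<Phi> \<circ> X) U Y)"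

text \<open>The analogue for an embedded surface given as a point set.\<close>

definition congruent_to_part_of_set ::
    "(real \<times> real \<Rightarrow> vec3) \<Rightarrow> (real \<times> real) set \<Rightarrow> vec3 set \<Rightarrow> bool" where
  "congruent_to_part_of_set X U S \<longleftrightarrow>
     (\<exists>\<Phi>. rigid_motion \<Phi> \<and> openin (top_of_set S) ((\<Phi> \<circ> X) ` U))"


section \<open>The surfaces in the classification\<close>

fun helicoid1 :: "real \<Rightarrow> real \<times> real \<Rightarrow> vec3" where
  "helicoid1 h (s, t) = (s * cos t, s * sin t, h * t)"

fun helicoid2 :: "real \<Rightarrow> real \<times> real \<Rightarrow> vec3" where
  "helicoid2 h (s, t) = (h * t, s * cosh t, s * sinh t)"

fun helicoid3 :: "real \<Rightarrow> real \<times> real \<Rightarrow> vec3" where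
  "helicoid3 h (s, t) = (h * t, s * sinh t, s * cosh t)"

fun cayley_surface :: "real \<Rightarrow> real \<times> real \<Rightarrow> vec3" where
  "cayley_surface h (s, t) =
     (s * t + h * (t ^ 3 / 3 - t), s + h * t\<^sup>2, s * t + h * (t ^ 3 / 3 + t))"

fun parabolic_null_cylinder :: "real \<Rightarrow> real \<Rightarrow> real \<times> real \<Rightarrow> vec3" where
  "parabolic_null_cylinder h b (s, t) =
     (s + b * t + h * (t ^ 3 / 3 - t), b + h * t\<^sup>2, s + b * t + h * (t ^ 3 / 3 + t))"

text \<open>The sign \<open>\<sigma>\<close> is meant to be \<open>1\<close> or \<open>- 1\<close> in the next two surfaces.\<close>

fun null_line_surface_timelike :: "real \<Rightarrow> real \<Rightarrow> real \<Rightarrow> real \<times> real \<Rightarrow> vec3" where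
  "null_line_surface_timelike h \<sigma> a\<^sub>0 (s, t) =
     (s * cos t, s * sin t, \<sigma> * s + a\<^sub>0 + h * t)"

fun null_line_surface_spacelike :: "real \<Rightarrow> real \<Rightarrow> real \<Rightarrow> real \<times> real \<Rightarrow> vec3" where
  "null_line_surface_spacelike h \<sigma> a\<^sub>0 (s, t) =
     (h * t, (\<sigma> * s + a\<^sub>0) * sinh t + s * cosh t, (\<sigma> * s + a\<^sub>0) * cosh t + s * sinh t)"

definition lorentzian_cylinder :: "real \<Rightarrow> vec3 set" where
  "lorentzian_cylinder r = {(x, y, z). x\<^sup>2 + y\<^sup>2 = r\<^sup>2}"

end

theory Submission
  imports Defs
begin

text \<open>The motions of the group are isometries which carry the surface to itself, so its geometry is
  determined along the generating curve.  Let \<open>D = E G - F\<^sup>2\<close> be the Gram determinant of the coordinate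
  fields there, and \<open>P = G det (X\<^sub>s, X\<^sub>t, X\<^sub>s\<^sub>s) - 2 F det (X\<^sub>s, X\<^sub>t, X\<^sub>s\<^sub>t) + E det (X\<^sub>s, X\<^sub>t, X\<^sub>t\<^sub>t)\<close>.
  Squaring the classical formula for the mean curvature removes the choice of the normal and of its
  sign and gives \<open>4 H\<^sup>2 \<bar>D\<bar>\<^sup>3 = P\<^sup>2\<close> (\<open>mean_curvature_squared\<close>).  Both sides can be written down for a
  polynomial generating curve, where \<open>D\<close> and \<open>P\<close> are polynomials in \<open>s\<close> (\<open>helicoidal_curvature\<close>).

  Since \<open>H\<close> is constant, the identity compares degrees: unless \<open>H = 0\<close>, the degrees satisfy
  \<open>3 deg D = 2 deg P\<close>.  Hence \<open>2 deg P < 3 deg D\<close> forces both \<open>H = 0\<close> and \<open>P = 0\<close>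
  (\<open>growth_forces_minimal\<close>).  For the graph of a polynomial of degree \<open>m \<ge> 2\<close> the pair \<open>(deg D, deg P)\<close>
  is \<open>(2m, 3m - 1)\<close>, \<open>(4m - 2, 3m - 2)\<close> and \<open>(2m - 2, m - 1)\<close> for timelike, spacelike and lightlike
  axis, so the inequality holds although \<open>P\<close> has a nonzero leading coefficient, a contradiction
  (\<open>degrees_of_nonlinear_graph\<close>).

  For a straight line \<open>D\<close> and \<open>P\<close> have degree at most \<open>2\<close>.  If \<open>D\<close> is not constant, the same
  comparison gives \<open>H = 0\<close> and the equation \<open>P = 0\<close> restricts the line; if \<open>D\<close> is constant, the
  identity is an equation for \<open>H\<close>.  The lines that remain generate the listed surfaces after a
  translation, or after a Lorentz transformation fixing the axis that turns a line through the axis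
  into a coordinate axis.\<close>

section \<open>The mean curvature of a parametrised surface\<close>

lemma lorentz_coords:
  "lorentz u v = fst u * fst v + fst (snd u) * fst (snd v) - snd (snd u) * snd (snd v)"
  by (cases u; cases v) auto

lemma bounded_bilinear_lorentz: "bounded_bilinear lorentz"
proof -
  have "bilinear lorentz"
    unfolding bilinear_def lorentz_coords
    by (auto intro!: linearI simp: algebra_simps)
  then show ?thesis
    using bilinear_conv_bounded_bilinear by blast
qed

text \<open>The third coordinate has the sign opposite to that of the Euclidean cross product, so that
  pairing with \<open>w\<close> in the Lorentzian product gives the determinant of \<open>u, v, w\<close>.\<close>
fun lorentz_cross :: "vec3 \<Rightarrow> vec3 \<Rightarrow> vec3" where
  "lorentz_cross (x, y, z) (x', y', z') = (y * z' - z * y', z * x' - x * z', y * x' - x * y')"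

definition gram :: "vec3 \<Rightarrow> vec3 \<Rightarrow> real" where
  "gram u v = lorentz u u * lorentz v v - (lorentz u v)\<^sup>2"

text \<open>\<open>e G - 2 f F + g E\<close>, where \<open>e, f, g\<close> are the coefficients of the second fundamental form with
  respect to the normal vector \<open>n\<close>, whose length is arbitrary; \<open>u, v\<close> are the first and \<open>a, b, c\<close> the
  second partial derivatives of the parametrisation.\<close>
definition curvature_numerator :: "vec3 \<Rightarrow> vec3 \<Rightarrow> vec3 \<Rightarrow> vec3 \<Rightarrow> vec3 \<Rightarrow> vec3 \<Rightarrow> real" where
  "curvature_numerator n u v a b c =
     lorentz v v * lorentz n a - 2 * lorentz u v * lorentz n b + lorentz u u * lorentz n c"

lemma lorentz_cross_self: "lorentz (lorentz_cross u v) (lorentz_cross u v) = - gram u v"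
  unfolding gram_def
  by (cases u; cases v) (simp add: power2_eq_square algebra_simps)

text \<open>The expansion of \<open>n\<close> in the frame \<open>u, v, u \<times> v\<close>, multiplied by the determinant so that it
  also holds on degenerate planes.  It shows that a vector orthogonal to \<open>u\<close> and \<open>v\<close> is a multiple of
  their cross product.\<close>
lemma gram_expansion:
  "gram u v *\<^sub>R n =
     (lorentz v v * lorentz n u - lorentz u v * lorentz n v) *\<^sub>R u
   + (lorentz u u * lorentz n v - lorentz u v * lorentz n u) *\<^sub>R v
   - lorentz n (lorentz_cross u v) *\<^sub>R lorentz_cross u v"
  unfolding gram_def
  by (cases u; cases v; cases n) (simp add: power2_eq_square algebra_simps)

text \<open>If \<open>E G = F\<^sup>2\<close>, then both \<open>E\<close> and \<open>G\<close> times the metric are perfect squares, so the metric is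
  semidefinite without being definite.\<close>
lemma gram_nonzero:
  assumes X: "(X has_derivative (\<lambda>d. fst d *\<^sub>R u + snd d *\<^sub>R v)) (at p)"
    and nondeg: "riemannian_at X p \<or> lorentzian_at X p"
  shows "gram u v \<noteq> 0"
proof
  assume D: "gram u v = 0"
  define E F G where "E = lorentz u u" and "F = lorentz u v" and "G = lorentz v v"
  have q: "induced_metric X p d d = E * (fst d)\<^sup>2 + 2 * F * fst d * snd d + G * (snd d)\<^sup>2" for d
    unfolding induced_metric_def frechet_derivative_at[OF X, symmetric] E_def F_def G_def
    by (simp add: lorentz_coords power2_eq_square algebra_simps)
  have D': "E * G = F\<^sup>2"
    using D by (simp add: gram_def E_def F_def G_def)
  have Eq: "E * induced_metric X p d d = (E * fst d + F * snd d)\<^sup>2"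
    and Gq: "G * induced_metric X p d d = (F * fst d + G * snd d)\<^sup>2" for d
    using D' unfolding q by algebra+
  from nondeg show False
  proof
    assume r: "riemannian_at X p"
    \<comment> \<open>For \<open>E > 0\<close> the parameter vector \<open>(- F, E)\<close> is nonzero and null.\<close>
    have "E > 0"
      using r[unfolded riemannian_at_def, rule_format, of "(1, 0)"] by (simp add: q zero_prod_def)
    then have "induced_metric X p (- F, E) (- F, E) > 0"
      using r by (simp add: riemannian_at_def zero_prod_def)
    moreover have "E * induced_metric X p (- F, E) (- F, E) = 0"
      unfolding Eq by simp
    ultimately show False
      using \<open>E > 0\<close> by simp
  next
    assume "lorentzian_at X p"
    then obtain d d' where d: "induced_metric X p d d > 0" and d': "induced_metric X p d' d' < 0"
      unfolding lorentzian_at_def by blast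
    have "0 \<le> E * induced_metric X p d d" "0 \<le> E * induced_metric X p d' d'"
      "0 \<le> G * induced_metric X p d d" "0 \<le> G * induced_metric X p d' d'"
      by (simp_all only: Eq Gq zero_le_power2)
    then have "E = 0" "G = 0"
      using d d' by (auto simp: zero_le_mult_iff)
    with D' d show False
      by (simp add: q)
  qed
qed

text \<open>Differentiating the orthogonality of \<open>N\<close> to \<open>X\<^sub>s\<close> and \<open>X\<^sub>t\<close> expresses the second fundamental form
  through second derivatives of \<open>X\<close>; solving the linear equations for the shape operator gives
  \<open>D trace A = e G - 2 f F + g E\<close>.  The unit normal is \<open>l\<close> times the cross product \<open>C\<close>, which has square
  \<open>- D\<close>, so that \<open>l\<^sup>2 \<bar>D\<bar> = 1\<close>, and squaring eliminates \<open>l\<close> together with the sign of \<open>\<langle>N, N\<rangle>\<close>.\<close>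
lemma mean_curvature_squared:
  assumes "open U" "p \<in> U"
    and X: "\<And>q. q \<in> U \<Longrightarrow> (X has_derivative (\<lambda>d. fst d *\<^sub>R X1 q + snd d *\<^sub>R X2 q)) (at q)"
    and X1: "(X1 has_derivative (\<lambda>d. fst d *\<^sub>R a + snd d *\<^sub>R b)) (at p)"
    and X2: "(X2 has_derivative (\<lambda>d. fst d *\<^sub>R b + snd d *\<^sub>R c)) (at p)"
    and N: "unit_normal_field X U N"
    and H: "has_mean_curvature_at X N p H"
    and nondeg: "gram (X1 p) (X2 p) \<noteq> 0"
  shows "4 * H\<^sup>2 * \<bar>gram (X1 p) (X2 p)\<bar> ^ 3 =
    (curvature_numerator (lorentz_cross (X1 p) (X2 p)) (X1 p) (X2 p) a b c)\<^sup>2"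
proof -
  interpret lor: bounded_bilinear lorentz
    by (rule bounded_bilinear_lorentz)
  have comm: "lorentz x y = lorentz y x" for x y
    by (simp add: lorentz_coords mult.commute)
  define u v n C where "u = X1 p" and "v = X2 p" and "n = N p" and "C = lorentz_cross u v"
  define D E F G where "D = gram u v" and "E = lorentz u u" and "F = lorentz u v"
    and "G = lorentz v v"
  have D: "D = E * G - F\<^sup>2"
    by (simp add: D_def E_def F_def G_def gram_def)
  have "D \<noteq> 0"
    using nondeg by (simp add: D_def u_def v_def)
  define dN where "dN = frechet_derivative N (at p)"
  have dN: "(N has_derivative dN) (at p)"
    using N \<open>p \<in> U\<close> unfolding unit_normal_field_def dN_def
    by (simp add: frechet_derivative_works)
  have eps: "\<bar>lorentz n n\<bar> = 1"
    using N \<open>p \<in> U\<close> unfolding unit_normal_field_def n_def by blast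
  have orth: "lorentz (N q) (X1 q) = 0" "lorentz (N q) (X2 q) = 0" if "q \<in> U" for q
  proof -
    have *: "lorentz (N q) (fst d *\<^sub>R X1 q + snd d *\<^sub>R X2 q) = 0" for d
    proof -
      have "lorentz (N q) (frechet_derivative X (at q) d) = 0"
        using N that unfolding unit_normal_field_def by blast
      then show ?thesis
        unfolding frechet_derivative_at[OF X[OF that], symmetric] .
    qed
    show "lorentz (N q) (X1 q) = 0" "lorentz (N q) (X2 q) = 0"
      using *[of "(1, 0)"] *[of "(0, 1)"] by simp_all
  qed
  have weingarten: "lorentz (dN d) (Y p) = - lorentz n (Y' d)"
    if Y: "(Y has_derivative Y') (at p)" and 0: "\<And>q. q \<in> U \<Longrightarrow> lorentz (N q) (Y q) = 0" for Y Y' d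
  proof -
    have "((\<lambda>q. lorentz (N q) (Y q)) has_derivative
        (\<lambda>d. lorentz (N p) (Y' d) + lorentz (dN d) (Y p))) (at p)"
      by (rule lor.FDERIV[OF dN Y])
    moreover have "((\<lambda>q. lorentz (N q) (Y q)) has_derivative (\<lambda>d. 0)) (at p)"
      by (rule has_derivative_transform_within_open[OF has_derivative_const[of 0] \<open>open U\<close> \<open>p \<in> U\<close>])
        (simp add: 0)
    ultimately have "(\<lambda>d. lorentz (N p) (Y' d) + lorentz (dN d) (Y p)) = (\<lambda>d. 0)"
      by (rule has_derivative_unique)
    then have "lorentz (N p) (Y' d) + lorentz (dN d) (Y p) = 0"
      by (rule fun_cong)
    then show ?thesis by (simp add: n_def)
  qed
  obtain A where A: "\<And>d. frechet_derivative X (at p) (A d) = - dN d"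
    and HA: "H = lorentz n n / 2 * endo_trace A"
    using H unfolding has_mean_curvature_at_def shape_operator_at_def dN_def n_def by blast
  have A': "- dN d = fst (A d) *\<^sub>R u + snd (A d) *\<^sub>R v" for d
    using A[of d] frechet_derivative_at[OF X[OF \<open>p \<in> U\<close>], symmetric] by (simp add: u_def v_def)
  have coeffs: "lorentz (- dN d) u = fst (A d) * E + snd (A d) * F"
    "lorentz (- dN d) v = fst (A d) * F + snd (A d) * G" for d
    unfolding A' E_def F_def G_def
    by (simp_all add: lor.add_left lor.scaleR_left comm[of v u])
  have eqs: "fst (A d) * E + snd (A d) * F = lorentz n (fst d *\<^sub>R a + snd d *\<^sub>R b)"
    "fst (A d) * F + snd (A d) * G = lorentz n (fst d *\<^sub>R b + snd d *\<^sub>R c)" for d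
    using weingarten[OF X1 orth(1), of d] weingarten[OF X2 orth(2), of d] coeffs[of d]
    by (simp_all add: lor.minus_left u_def v_def)
  define T where "T = endo_trace A"
  have T: "T = fst (A (1, 0)) + snd (A (0, 1))"
    unfolding T_def endo_trace_def Basis_prod_def
    by (subst sum.union_disjoint) (auto simp: inner_prod_def)
  have TD: "T * D = curvature_numerator n u v a b c"
  proof -
    have "curvature_numerator n u v a b c =
        G * lorentz n a - F * lorentz n b - F * lorentz n b + E * lorentz n c"
      by (simp add: curvature_numerator_def E_def F_def G_def)
    also have "\<dots> = G * (fst (A (1, 0)) * E + snd (A (1, 0)) * F)
        - F * (fst (A (1, 0)) * F + snd (A (1, 0)) * G)
        - F * (fst (A (0, 1)) * E + snd (A (0, 1)) * F)
        + E * (fst (A (0, 1)) * F + snd (A (0, 1)) * G)"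
      unfolding eqs by simp
    also have "\<dots> = T * D"
      unfolding T D by (simp add: power2_eq_square algebra_simps)
    finally show ?thesis by simp
  qed
  define l where "l = - lorentz n C / D"
  have "D *\<^sub>R n = - lorentz n C *\<^sub>R C"
    using gram_expansion[of u v n] orth[OF \<open>p \<in> U\<close>] by (simp add: D_def C_def n_def u_def v_def)
  then have "(1 / D) *\<^sub>R (D *\<^sub>R n) = (1 / D) *\<^sub>R (- lorentz n C *\<^sub>R C)"
    by simp
  then have n: "n = l *\<^sub>R C"
    using \<open>D \<noteq> 0\<close> by (simp add: l_def)
  have "lorentz n n = - (l\<^sup>2 * D)"
    unfolding n by (simp add: lor.scaleR_left lor.scaleR_right C_def lorentz_cross_self
        D_def power2_eq_square)
  then have l: "l\<^sup>2 * \<bar>D\<bar> = 1"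
    using eps by (simp add: abs_mult)
  have "T * D = l * curvature_numerator C u v a b c"
    unfolding TD curvature_numerator_def
    unfolding n by (simp add: lor.scaleR_left algebra_simps)
  then have sq: "T\<^sup>2 * D\<^sup>2 = l\<^sup>2 * (curvature_numerator C u v a b c)\<^sup>2"
    by (metis power_mult_distrib)
  have "(lorentz n n)\<^sup>2 = 1"
    using eps by (metis power2_abs one_power2)
  then have "4 * H\<^sup>2 = T\<^sup>2"
    unfolding HA T_def by (simp add: power_mult_distrib power_divide)
  then have "4 * H\<^sup>2 * \<bar>D\<bar> ^ 3 = T\<^sup>2 * D\<^sup>2 * \<bar>D\<bar>"
    by (simp add: power3_eq_cube power2_eq_square)
  also have "\<dots> = (l\<^sup>2 * \<bar>D\<bar>) * (curvature_numerator C u v a b c)\<^sup>2"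
    unfolding sq by simp
  finally show ?thesis
    unfolding l by (simp add: D_def C_def u_def v_def)
qed

section \<open>The curvature identity along the generating curve\<close>

text \<open>A polynomial curve in the coordinate plane belonging to the axis.  Graphs are the case of
  \<open>p = [:0, 1:]\<close>, and the straight lines which are not graphs are the case of a constant \<open>p\<close> with
  \<open>q = [:0, 1:]\<close>, so that both kinds are covered by one computation.\<close>
fun profile_curve :: "axis \<Rightarrow> real poly \<Rightarrow> real poly \<Rightarrow> real \<Rightarrow> vec3" where
  "profile_curve Timelike p q s = (poly p s, 0, poly q s)"
| "profile_curve Spacelike p q s = (0, poly p s, poly q s)"
| "profile_curve Lightlike p q s = (poly q s, poly p s, poly q s)"

text \<open>The Gram determinant \<open>E G - F\<^sup>2\<close> of the helicoidal surface at \<open>t = 0\<close>.\<close>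
fun gram_poly :: "axis \<Rightarrow> real \<Rightarrow> real poly \<Rightarrow> real poly \<Rightarrow> real poly" where
  "gram_poly Timelike h p q =
     p\<^sup>2 * ((pderiv p)\<^sup>2 - (pderiv q)\<^sup>2) - smult (h\<^sup>2) ((pderiv p)\<^sup>2)"
| "gram_poly Spacelike h p q =
     smult (h\<^sup>2) ((pderiv p)\<^sup>2 - (pderiv q)\<^sup>2) - (p * pderiv p - q * pderiv q)\<^sup>2"
| "gram_poly Lightlike h p q =
     smult (- 4 * h) (p * (pderiv p)\<^sup>2) - smult (4 * h\<^sup>2) ((pderiv q)\<^sup>2)"

text \<open>The curvature numerator of the helicoidal surface at \<open>t = 0\<close>, with the cross product of the
  coordinate fields as normal vector.\<close>
fun numerator_poly :: "axis \<Rightarrow> real \<Rightarrow> real poly \<Rightarrow> real poly \<Rightarrow> real poly" where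
  "numerator_poly Timelike h p q =
     (p\<^sup>2 - [:h\<^sup>2:]) * p * (pderiv p * pderiv (pderiv q) - pderiv (pderiv p) * pderiv q)
     - smult (2 * h\<^sup>2) ((pderiv p)\<^sup>2 * pderiv q)
     + ((pderiv p)\<^sup>2 - (pderiv q)\<^sup>2) * p\<^sup>2 * pderiv q"
| "numerator_poly Spacelike h p q =
     smult h (([:h\<^sup>2:] + q\<^sup>2 - p\<^sup>2) * (pderiv q * pderiv (pderiv p) - pderiv p * pderiv (pderiv q))
       + ((pderiv p)\<^sup>2 - (pderiv q)\<^sup>2) * (pderiv p * q - pderiv q * p))"
| "numerator_poly Lightlike h p q =
     smult (4 * h\<^sup>2) (pderiv q * (pderiv p)\<^sup>2
       - smult 2 (p * (pderiv p * pderiv (pderiv q) - pderiv (pderiv p) * pderiv q)))"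

lemma has_derivative_poly:
  fixes p :: "real poly"
  assumes "(f has_derivative f') (at x within S)"
  shows "((\<lambda>x. poly p (f x)) has_derivative (\<lambda>d. poly (pderiv p) (f x) * f' d)) (at x within S)"
  using DERIV_compose_FDERIV[OF poly_DERIV assms, of p] by (simp add: mult.commute)

lemma has_derivative_sinh_compose:
  fixes f :: "'a :: real_normed_vector \<Rightarrow> real"
  assumes "(f has_derivative f') (at x within S)"
  shows "((\<lambda>x. sinh (f x)) has_derivative (\<lambda>d. cosh (f x) * f' d)) (at x within S)"
  using DERIV_compose_FDERIV[OF has_field_derivative_sinh[OF DERIV_ident] assms]
  by (simp add: mult.commute)

lemma has_derivative_cosh_compose:
  fixes f :: "'a :: real_normed_vector \<Rightarrow> real"
  assumes "(f has_derivative f') (at x within S)"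
  shows "((\<lambda>x. cosh (f x)) has_derivative (\<lambda>d. sinh (f x) * f' d)) (at x within S)"
  using DERIV_compose_FDERIV[OF has_field_derivative_cosh[OF DERIV_ident] assms]
  by (simp add: mult.commute)

text \<open>Evaluation at \<open>t = 0\<close> suffices, because a helicoidal surface looks the same along each orbit of
  the group, and it removes the transcendental functions of \<open>t\<close>.\<close>
lemma helicoidal_curvature:
  assumes "open I" "s \<in> I"
    and nondeg: "nondegenerate_surface (helicoidal_surface K h (profile_curve K p q)) (I \<times> UNIV)"
    and N: "unit_normal_field (helicoidal_surface K h (profile_curve K p q)) (I \<times> UNIV) N"
    and H: "\<forall>z\<in>I \<times> UNIV.
      has_mean_curvature_at (helicoidal_surface K h (profile_curve K p q)) N z H"
  shows "poly (gram_poly K h p q) s \<noteq> 0 \<and>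
    4 * H\<^sup>2 * \<bar>poly (gram_poly K h p q) s\<bar> ^ 3 = (poly (numerator_poly K h p q) s)\<^sup>2"
proof -
  define X where "X = helicoidal_surface K h (profile_curve K p q)"
  have U: "open (I \<times> (UNIV :: real set))" "(s, 0) \<in> I \<times> (UNIV :: real set)"
    using assms by (simp_all add: open_Times)
  have nd: "riemannian_at X z \<or> lorentzian_at X z" if "z \<in> I \<times> UNIV" for z
    using nondeg that unfolding nondegenerate_surface_def X_def by blast
  have *: "gram (X1 (s, 0)) (X2 (s, 0)) \<noteq> 0 \<and>
      4 * H\<^sup>2 * \<bar>gram (X1 (s, 0)) (X2 (s, 0))\<bar> ^ 3 =
      (curvature_numerator (lorentz_cross (X1 (s, 0)) (X2 (s, 0))) (X1 (s, 0)) (X2 (s, 0)) a b c)\<^sup>2"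
    if "\<And>z. (X has_derivative (\<lambda>d. fst d *\<^sub>R X1 z + snd d *\<^sub>R X2 z)) (at z)"
      and "(X1 has_derivative (\<lambda>d. fst d *\<^sub>R a + snd d *\<^sub>R b)) (at (s, 0))"
      and "(X2 has_derivative (\<lambda>d. fst d *\<^sub>R b + snd d *\<^sub>R c)) (at (s, 0))"
    for X1 X2 a b c
    using gram_nonzero[OF that(1) nd[OF U(2)]]
      mean_curvature_squared[OF U that(1) that(2,3) N[folded X_def], of H] H U(2)
    unfolding X_def by blast
  define x y x' y' x'' y'' where "x = poly p" and "y = poly q"
    and "x' = poly (pderiv p)" and "y' = poly (pderiv q)"
    and "x'' = poly (pderiv (pderiv p))" and "y'' = poly (pderiv (pderiv q))"
  note defs = x_def y_def x'_def y'_def x''_def y''_def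
  note [derivative_intros] = has_derivative_poly has_derivative_sinh_compose
    has_derivative_cosh_compose
  show ?thesis
  proof (cases K)
    case Timelike
    have X: "X = (\<lambda>z. (x (fst z) * cos (snd z), x (fst z) * sin (snd z), y (fst z) + h * snd z))"
      by (auto simp: X_def helicoidal_surface_def Timelike defs algebra_simps)
    define X1 where "X1 = (\<lambda>z :: real \<times> real. (x' (fst z) * cos (snd z),
        x' (fst z) * sin (snd z), y' (fst z)))"
    define X2 where "X2 = (\<lambda>z :: real \<times> real. (- x (fst z) * sin (snd z),
        x (fst z) * cos (snd z), h))"
    define a b c where "a = (x'' s, 0 :: real, y'' s)" and "b = (0 :: real, x' s, 0 :: real)"
      and "c = (- x s, 0 :: real, 0 :: real)"
    have deriv: "\<And>z. (X has_derivative (\<lambda>d. fst d *\<^sub>R X1 z + snd d *\<^sub>R X2 z)) (at z)"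
      unfolding X X1_def X2_def defs
      by (auto intro!: derivative_eq_intros simp: fun_eq_iff algebra_simps power2_eq_square)
    have deriv1: "(X1 has_derivative (\<lambda>d. fst d *\<^sub>R a + snd d *\<^sub>R b)) (at (s, 0))"
      unfolding X1_def a_def b_def defs
      by (auto intro!: derivative_eq_intros simp: fun_eq_iff algebra_simps)
    have deriv2: "(X2 has_derivative (\<lambda>d. fst d *\<^sub>R b + snd d *\<^sub>R c)) (at (s, 0))"
      unfolding X2_def b_def c_def defs
      by (auto intro!: derivative_eq_intros simp: fun_eq_iff algebra_simps)
    have D: "gram (X1 (s, 0)) (X2 (s, 0)) = poly (gram_poly K h p q) s"
      unfolding gram_def X1_def X2_def defs
      by (simp add: Timelike power2_eq_square algebra_simps)
    have P: "curvature_numerator (lorentz_cross (X1 (s, 0)) (X2 (s, 0)))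
        (X1 (s, 0)) (X2 (s, 0)) a b c = poly (numerator_poly K h p q) s"
      unfolding curvature_numerator_def X1_def X2_def a_def b_def c_def defs
      by (simp add: Timelike power2_eq_square algebra_simps)
    show ?thesis
      using *[OF deriv deriv1 deriv2] unfolding D P .
  next
    case Spacelike
    have X: "X = (\<lambda>z. (h * snd z, x (fst z) * cosh (snd z) + y (fst z) * sinh (snd z),
        x (fst z) * sinh (snd z) + y (fst z) * cosh (snd z)))"
      by (auto simp: X_def helicoidal_surface_def Spacelike defs algebra_simps)
    define X1 where "X1 = (\<lambda>z :: real \<times> real. (0 :: real,
        x' (fst z) * cosh (snd z) + y' (fst z) * sinh (snd z),
        x' (fst z) * sinh (snd z) + y' (fst z) * cosh (snd z)))"
    define X2 where "X2 = (\<lambda>z :: real \<times> real. (h,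
        x (fst z) * sinh (snd z) + y (fst z) * cosh (snd z),
        x (fst z) * cosh (snd z) + y (fst z) * sinh (snd z)))"
    define a b c where "a = (0 :: real, x'' s, y'' s)" and "b = (0 :: real, y' s, x' s)"
      and "c = (0 :: real, x s, y s)"
    have deriv: "\<And>z. (X has_derivative (\<lambda>d. fst d *\<^sub>R X1 z + snd d *\<^sub>R X2 z)) (at z)"
      unfolding X X1_def X2_def defs
      by (auto intro!: derivative_eq_intros simp: fun_eq_iff algebra_simps power2_eq_square)
    have deriv1: "(X1 has_derivative (\<lambda>d. fst d *\<^sub>R a + snd d *\<^sub>R b)) (at (s, 0))"
      unfolding X1_def a_def b_def defs
      by (auto intro!: derivative_eq_intros simp: fun_eq_iff algebra_simps)
    have deriv2: "(X2 has_derivative (\<lambda>d. fst d *\<^sub>R b + snd d *\<^sub>R c)) (at (s, 0))"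
      unfolding X2_def b_def c_def defs
      by (auto intro!: derivative_eq_intros simp: fun_eq_iff algebra_simps)
    have D: "gram (X1 (s, 0)) (X2 (s, 0)) = poly (gram_poly K h p q) s"
      unfolding gram_def X1_def X2_def defs
      by (simp add: Spacelike power2_eq_square algebra_simps)
    have P: "curvature_numerator (lorentz_cross (X1 (s, 0)) (X2 (s, 0)))
        (X1 (s, 0)) (X2 (s, 0)) a b c = poly (numerator_poly K h p q) s"
      unfolding curvature_numerator_def X1_def X2_def a_def b_def c_def defs
      by (simp add: Spacelike power2_eq_square algebra_simps)
    show ?thesis
      using *[OF deriv deriv1 deriv2] unfolding D P .
  next
    case Lightlike
    have X: "X = (\<lambda>z. (y (fst z) + snd z * x (fst z) + h * (snd z ^ 3 / 3 - snd z),
        x (fst z) + h * (snd z)\<^sup>2,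
        y (fst z) + snd z * x (fst z) + h * (snd z ^ 3 / 3 + snd z)))"
      by (auto simp: X_def helicoidal_surface_def Lightlike defs algebra_simps)
    define X1 where "X1 = (\<lambda>z :: real \<times> real. (y' (fst z) + snd z * x' (fst z),
        x' (fst z), y' (fst z) + snd z * x' (fst z)))"
    define X2 where "X2 = (\<lambda>z :: real \<times> real. (x (fst z) + h * ((snd z)\<^sup>2 - 1),
        2 * h * snd z, x (fst z) + h * ((snd z)\<^sup>2 + 1)))"
    define a b c where "a = (y'' s, x'' s, y'' s)" and "b = (x' s, 0 :: real, x' s)"
      and "c = (0 :: real, 2 * h, 0 :: real)"
    have deriv: "\<And>z. (X has_derivative (\<lambda>d. fst d *\<^sub>R X1 z + snd d *\<^sub>R X2 z)) (at z)"
      unfolding X X1_def X2_def defs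
      by (auto intro!: derivative_eq_intros simp: fun_eq_iff algebra_simps power2_eq_square)
    have deriv1: "(X1 has_derivative (\<lambda>d. fst d *\<^sub>R a + snd d *\<^sub>R b)) (at (s, 0))"
      unfolding X1_def a_def b_def defs
      by (auto intro!: derivative_eq_intros simp: fun_eq_iff algebra_simps)
    have deriv2: "(X2 has_derivative (\<lambda>d. fst d *\<^sub>R b + snd d *\<^sub>R c)) (at (s, 0))"
      unfolding X2_def b_def c_def defs
      by (auto intro!: derivative_eq_intros simp: fun_eq_iff algebra_simps)
    have D: "gram (X1 (s, 0)) (X2 (s, 0)) = poly (gram_poly K h p q) s"
      unfolding gram_def X1_def X2_def defs
      by (simp add: Lightlike power2_eq_square algebra_simps)
    have P: "curvature_numerator (lorentz_cross (X1 (s, 0)) (X2 (s, 0)))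
        (X1 (s, 0)) (X2 (s, 0)) a b c = poly (numerator_poly K h p q) s"
      unfolding curvature_numerator_def X1_def X2_def a_def b_def c_def defs
      by (simp add: Lightlike power2_eq_square algebra_simps)
    show ?thesis
      using *[OF deriv deriv1 deriv2] unfolding D P .
  qed
qed

section \<open>Comparison of degrees\<close>

text \<open>The identity is squared to remove the absolute value; it then holds between polynomials, and
  a nonzero constant on the left would make \<open>6 deg D = 4 deg P\<close>.\<close>
lemma growth_forces_minimal:
  fixes D P :: "real poly"
  assumes "open I" "I \<noteq> {}"
    and eq: "\<And>s. s \<in> I \<Longrightarrow> 4 * H\<^sup>2 * \<bar>poly D s\<bar> ^ 3 = (poly P s)\<^sup>2"
    and deg: "2 * degree P < 3 * degree D"
  shows "H = 0 \<and> P = 0"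
proof -
  define c where "c = (4 * H\<^sup>2)\<^sup>2"
  have "poly (smult c (D ^ 6) - P ^ 4) s = 0" if "s \<in> I" for s
  proof -
    have "(4 * H\<^sup>2 * \<bar>poly D s\<bar> ^ 3)\<^sup>2 = ((poly P s)\<^sup>2)\<^sup>2"
      using eq[OF that] by simp
    then show ?thesis
      by (simp add: c_def power_mult_distrib power_even_abs flip: power_mult)
  qed
  then have "I \<subseteq> {s. poly (smult c (D ^ 6) - P ^ 4) s = 0}"
    by blast
  moreover have "infinite I"
    using assms(1,2) finite_imp_not_open by blast
  ultimately have "smult c (D ^ 6) - P ^ 4 = 0"
    using poly_roots_finite finite_subset by blast
  then have *: "smult c (D ^ 6) = P ^ 4"
    by simp
  have "c = 0"
  proof (rule ccontr)
    assume "c \<noteq> 0"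
    then have "6 * degree D = degree (P ^ 4)"
      using * by (metis degree_smult_eq degree_power_eq deg degree_0 mult_0_right not_less0)
    also have "\<dots> \<le> 4 * degree P"
      using degree_power_le[of P 4] by (simp add: mult.commute)
    finally show False using deg by simp
  qed
  then show ?thesis
    using * by (simp add: c_def)
qed

section \<open>Leading coefficients\<close>

text \<open>An upper bound for the degree together with the coefficient at that bound, which may vanish.
  Unlike the degree and the leading coefficient, this is additive when leading terms cancel.\<close>
definition top_coeff :: "real poly \<Rightarrow> nat \<Rightarrow> real \<Rightarrow> bool" where
  "top_coeff p k c \<longleftrightarrow> degree p \<le> k \<and> coeff p k = c"

lemma top_coeff_mult:
  assumes "top_coeff p j c" "top_coeff q k d"
  shows "top_coeff (p * q) (j + k) (c * d)"
proof -
  have "degree (p * q) \<le> j + k"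
    using assms degree_mult_le[of p q] by (auto simp: top_coeff_def)
  moreover have "coeff (p * q) (j + k) = (\<Sum>i\<le>j + k. if i = j then c * d else 0)"
    unfolding coeff_mult
  proof (rule sum.cong[OF refl])
    fix i assume "i \<in> {..j + k}"
    show "coeff p i * coeff q (j + k - i) = (if i = j then c * d else 0)"
    proof (cases i j rule: linorder_cases)
      case less
      then have "degree q < j + k - i"
        using assms(2) by (auto simp: top_coeff_def)
      then show ?thesis using less by (simp add: coeff_eq_0)
    next
      case greater
      then have "degree p < i"
        using assms(1) by (auto simp: top_coeff_def)
      then show ?thesis using greater by (simp add: coeff_eq_0)
    qed (use assms in \<open>auto simp: top_coeff_def\<close>)
  qed
  ultimately show ?thesis
    by (simp add: top_coeff_def)
qed

lemma top_coeff_cong: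
  "top_coeff p k c \<Longrightarrow> p = p' \<Longrightarrow> k = k' \<Longrightarrow> c = c' \<Longrightarrow> top_coeff p' k' c'"
  by simp

lemma top_coeff_add:
  "top_coeff p k c \<Longrightarrow> top_coeff q k d \<Longrightarrow> top_coeff (p + q) k (c + d)"
  by (auto simp: top_coeff_def intro: degree_add_le)

lemma top_coeff_diff:
  "top_coeff p k c \<Longrightarrow> top_coeff q k d \<Longrightarrow> top_coeff (p - q) k (c - d)"
  by (auto simp: top_coeff_def intro: degree_diff_le)

lemma top_coeff_smult: "top_coeff p k c \<Longrightarrow> top_coeff (smult a p) k (a * c)"
  by (auto simp: top_coeff_def intro: order_trans[OF degree_smult_le])

text \<open>Terms of lower degree enter a sum at the top degree with coefficient \<open>0\<close>.\<close>
lemma top_coeff_raise: "top_coeff p j c \<Longrightarrow> j < k \<Longrightarrow> top_coeff p k 0"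
  by (auto simp: top_coeff_def coeff_eq_0)

lemma top_coeff_square: "top_coeff p k c \<Longrightarrow> top_coeff (p\<^sup>2) (2 * k) (c\<^sup>2)"
  using top_coeff_mult[of p k c p k c] by (simp add: power2_eq_square mult_2)

lemma top_coeff_pderiv: "top_coeff p (Suc k) c \<Longrightarrow> top_coeff (pderiv p) k (real (Suc k) * c)"
  by (auto simp: top_coeff_def degree_pderiv coeff_pderiv)

lemma top_coeff_nonzero: "top_coeff p k c \<Longrightarrow> c \<noteq> 0 \<Longrightarrow> p \<noteq> 0 \<and> degree p = k"
  by (auto simp: top_coeff_def intro: le_antisym le_degree)

text \<open>Let \<open>a\<close> and \<open>n + 2\<close> be the leading coefficient and the degree of \<open>f\<close>.  The leading coefficients of
  the Gram determinant and of the numerator are nonzero multiples of powers of \<open>a\<close>.  Only for a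
  spacelike axis do two terms of the numerator compete at the top degree: \<open>- f'' f\<^sup>2\<close> and
  \<open>- f'\<^sup>2 (f - s f')\<close> contribute \<open>- (n + 2) (n + 1) a\<^sup>3\<close> and \<open>(n + 2)\<^sup>2 (n + 1) a\<^sup>3\<close>.\<close>
lemma degrees_of_nonlinear_graph:
  assumes "h \<noteq> 0" "2 \<le> degree f"
  shows "2 * degree (numerator_poly K h [:0, 1:] f) < 3 * degree (gram_poly K h [:0, 1:] f) \<and>
    numerator_poly K h [:0, 1:] f \<noteq> 0"
proof -
  define n where "n = degree f - 2"
  define a where "a = lead_coeff f"
  have "a \<noteq> 0" using assms(2) by (auto simp: a_def)
  define x :: "real poly" where "x = [:0, 1:]"
  define f' f'' where "f' = pderiv f" and "f'' = pderiv f'"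
  define b c where "b = real (n + 2) * a" and "c = real (n + 1) * b"
  have x: "top_coeff x 1 1" "top_coeff (x\<^sup>2) 2 1" and one: "top_coeff 1 0 1"
    and const: "top_coeff [:d:] 0 d" for d
    using top_coeff_square[of x 1 1] by (auto simp: top_coeff_def x_def)
  have f: "top_coeff f (n + 2) a"
    using assms(2) by (simp add: top_coeff_def n_def a_def le_add_diff_inverse2 del: add_2_eq_Suc')
  have f': "top_coeff f' (n + 1) b"
    using top_coeff_pderiv[of f "n + 1" a] f by (simp add: f'_def b_def)
  have f'': "top_coeff f'' n c"
    using top_coeff_pderiv[of f' n b] f' by (simp add: f''_def c_def)
  have "b \<noteq> 0"
    using \<open>a \<noteq> 0\<close> by (simp add: b_def)
  note f'2 = top_coeff_square[OF f']
  have one_f'2: "top_coeff (1 - f'\<^sup>2) (2 * (n + 1)) (- b\<^sup>2)"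
    using top_coeff_diff[OF top_coeff_raise[OF one] f'2] by simp
  have dx: "pderiv x = 1" "pderiv 1 = (0 :: real poly)"
    by (simp_all add: x_def pderiv_pCons one_pCons)
  show ?thesis
  proof (cases K)
    case Timelike
    have "top_coeff (x\<^sup>2 * (1 - f'\<^sup>2) - smult (h\<^sup>2) 1) (2 + 2 * (n + 1)) (1 * (- b\<^sup>2) - 0)"
      by (intro top_coeff_diff top_coeff_mult x one_f'2
          top_coeff_raise[OF top_coeff_smult[OF one]]) simp
    then have D: "top_coeff (gram_poly K h x f) (2 * n + 4) (- b\<^sup>2)"
      by (rule top_coeff_cong) (simp_all add: Timelike dx f'_def)
    have "top_coeff ((x\<^sup>2 - [:h\<^sup>2:]) * x * f'') (2 + 1 + n) ((1 - 0) * 1 * c)"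
      by (intro top_coeff_mult top_coeff_diff x f'' top_coeff_raise[OF const]) simp
    then have "top_coeff ((x\<^sup>2 - [:h\<^sup>2:]) * x * f'' - smult (2 * h\<^sup>2) f' + (1 - f'\<^sup>2) * x\<^sup>2 * f')
        (2 * (n + 1) + 2 + (n + 1)) (0 - 0 + (- b\<^sup>2) * 1 * b)"
      by (intro top_coeff_diff top_coeff_add top_coeff_mult one_f'2 x f'
          top_coeff_raise[OF top_coeff_smult[OF f']]) (auto elim!: top_coeff_raise)
    then have P: "top_coeff (numerator_poly K h x f) (3 * n + 5) (- (b ^ 3))"
      by (rule top_coeff_cong)
        (simp_all add: Timelike dx f'_def f''_def power2_eq_square power3_eq_cube algebra_simps)
    show ?thesis
      using top_coeff_nonzero[OF D] top_coeff_nonzero[OF P] \<open>b \<noteq> 0\<close> by (simp add: x_def)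
  next
    case Spacelike
    have "top_coeff (x - f * f') (n + 2 + (n + 1)) (0 - a * b)"
      by (intro top_coeff_diff top_coeff_mult f f' top_coeff_raise[OF x(1)]) simp
    then have "top_coeff ((x - f * f')\<^sup>2) (2 * (n + 2 + (n + 1))) ((0 - a * b)\<^sup>2)"
      by (rule top_coeff_square)
    then have "top_coeff (smult (h\<^sup>2) (1 - f'\<^sup>2) - (x - f * f')\<^sup>2)
        (2 * (n + 2 + (n + 1))) (0 - (0 - a * b)\<^sup>2)"
      by (intro top_coeff_diff top_coeff_raise[OF top_coeff_smult[OF one_f'2]]) auto
    then have D: "top_coeff (gram_poly K h x f) (4 * n + 6) (- (a * b)\<^sup>2)"
      by (rule top_coeff_cong) (simp_all add: Spacelike dx f'_def power2_eq_square algebra_simps)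
    have U: "top_coeff ([:h\<^sup>2:] + f\<^sup>2 - x\<^sup>2) (2 * (n + 2)) (0 + a\<^sup>2 - 0)"
      by (intro top_coeff_diff top_coeff_add top_coeff_square f top_coeff_raise[OF const]
          top_coeff_raise[OF x(2)]) auto
    have V: "top_coeff (0 - f'') n (0 - c)"
      by (intro top_coeff_diff f'') (simp add: top_coeff_def)
    have W: "top_coeff (f - f' * x) (n + 1 + 1) (a - b * 1)"
      using f by (intro top_coeff_diff top_coeff_mult f' x) simp
    have "top_coeff (([:h\<^sup>2:] + f\<^sup>2 - x\<^sup>2) * (0 - f'')) (3 * n + 4) (- (a\<^sup>2 * c))"
      using top_coeff_mult[OF U V] by (rule top_coeff_cong) simp_all
    moreover have "top_coeff ((1 - f'\<^sup>2) * (f - f' * x)) (3 * n + 4) (- b\<^sup>2 * (a - b))"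
      using top_coeff_mult[OF one_f'2 W] by (rule top_coeff_cong) simp_all
    ultimately have "top_coeff (([:h\<^sup>2:] + f\<^sup>2 - x\<^sup>2) * (0 - f'') + (1 - f'\<^sup>2) * (f - f' * x))
        (3 * n + 4) (- (a\<^sup>2 * c) + - b\<^sup>2 * (a - b))"
      by (rule top_coeff_add)
    from top_coeff_smult[OF this, of h]
    have P: "top_coeff (numerator_poly K h x f) (3 * n + 4) (h * (b\<^sup>2 * (b - a) - a\<^sup>2 * c))"
      by (rule top_coeff_cong)
        (simp_all add: Spacelike dx f'_def f''_def power2_eq_square algebra_simps)
    have "b\<^sup>2 * (b - a) - a\<^sup>2 * c = real (n + 2) * real (n + 1) ^ 2 * a ^ 3"
      by (simp add: b_def c_def power2_eq_square power3_eq_cube algebra_simps)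
    then have "h * (b\<^sup>2 * (b - a) - a\<^sup>2 * c) \<noteq> 0"
      using \<open>a \<noteq> 0\<close> \<open>h \<noteq> 0\<close> by simp
    then show ?thesis
      using top_coeff_nonzero[OF D] top_coeff_nonzero[OF P] \<open>a \<noteq> 0\<close> \<open>b \<noteq> 0\<close> by (simp add: x_def)
  next
    case Lightlike
    have "top_coeff (smult (- 4 * h) x - smult (4 * h\<^sup>2) (f'\<^sup>2)) (2 * (n + 1)) (0 - 4 * h\<^sup>2 * b\<^sup>2)"
      by (intro top_coeff_diff top_coeff_smult f'2 top_coeff_raise[OF top_coeff_smult[OF x(1)]]) simp
    then have D: "top_coeff (gram_poly K h x f) (2 * n + 2) (- 4 * h\<^sup>2 * b\<^sup>2)"
      by (rule top_coeff_cong) (simp_all add: Lightlike dx f'_def)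
    have "top_coeff (smult (4 * h\<^sup>2) (f' - smult 2 (x * f''))) (1 + n) (4 * h\<^sup>2 * (b - 2 * (1 * c)))"
      using f' by (intro top_coeff_smult top_coeff_diff top_coeff_mult x f'') simp
    then have P: "top_coeff (numerator_poly K h x f) (n + 1) (4 * h\<^sup>2 * (b - 2 * c))"
      by (rule top_coeff_cong) (simp_all add: Lightlike dx f'_def f''_def)
    \<comment> \<open>The two terms of the numerator have equal degree; their sum vanishes for no \<open>n\<close>.\<close>
    have "b - 2 * c = - (real (2 * n + 1) * b)"
      by (simp add: c_def algebra_simps)
    then have "4 * h\<^sup>2 * (b - 2 * c) \<noteq> 0"
      using \<open>b \<noteq> 0\<close> \<open>h \<noteq> 0\<close> by simp
    then show ?thesis
      using top_coeff_nonzero[OF D] top_coeff_nonzero[OF P] \<open>b \<noteq> 0\<close> \<open>h \<noteq> 0\<close> by (simp add: x_def)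
  qed
qed

section \<open>Congruences\<close>

lemma open_part_of_scaled:
  assumes "open U" "c \<noteq> 0" and eq: "\<And>s t. (s, t) \<in> U \<Longrightarrow> X (s, t) = Y (c * s, t)"
  shows "open_part_of X U Y"
proof -
  define \<psi> where "\<psi> = (\<lambda>z :: real \<times> real. (c * fst z, snd z))"
  define \<theta> where "\<theta> = (\<lambda>z :: real \<times> real. (fst z / c, snd z))"
  have inv: "\<theta> (\<psi> z) = z" "\<psi> (\<theta> z) = z" for z
    using \<open>c \<noteq> 0\<close> by (simp_all add: \<psi>_def \<theta>_def)
  have cont: "continuous_on S \<psi>" "continuous_on S \<theta>" for S
    unfolding \<psi>_def \<theta>_def using \<open>c \<noteq> 0\<close> by (auto intro!: continuous_intros)
  have diff: "\<psi> differentiable_on S" "\<theta> differentiable_on S" for S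
    unfolding \<psi>_def \<theta>_def differentiable_on_def differentiable_def using \<open>c \<noteq> 0\<close>
    by (auto intro!: exI derivative_eq_intros)
  have "homeomorphism U (\<theta> -` U) \<psi> \<theta>"
    using cont inv by (intro homeomorphismI) auto
  moreover have "open (\<theta> -` U)"
    using \<open>open U\<close> cont(2) by (rule open_vimage)
  moreover have "\<forall>z\<in>U. X z = Y (\<psi> z)"
    using eq by (auto simp: \<psi>_def)
  ultimately show ?thesis
    unfolding open_part_of_def using diff by blast
qed

lemma rigid_motion_translation: "rigid_motion (\<lambda>x. x + p)"
  unfolding rigid_motion_def
  by (intro exI[of _ "\<lambda>x. x"] exI[of _ p]) (simp add: linear_ident)

text \<open>With \<open>\<alpha> = \<plusminus> cosh u\<close> and \<open>\<beta> = \<plusminus> sinh u\<close> this is a boost along the spacelike axis, followed by \<open>- 1\<close> on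
  the plane \<open>x = 0\<close> if \<open>\<alpha> < 0\<close>; it normalises the slope of a line in that plane.\<close>
lemma rigid_motion_boost:
  assumes "\<alpha>\<^sup>2 - \<beta>\<^sup>2 = 1"
  shows "rigid_motion (\<lambda>(x, y, z). (x, \<alpha> * y - \<beta> * z, \<alpha> * z - \<beta> * y))"
proof -
  define L :: "vec3 \<Rightarrow> vec3"
    where "L = (\<lambda>v. (fst v, \<alpha> * fst (snd v) - \<beta> * snd (snd v), \<alpha> * snd (snd v) - \<beta> * fst (snd v)))"
  have "linear L"
    unfolding L_def by (auto intro!: linearI simp: algebra_simps)
  moreover have "lorentz (L u) (L v) = lorentz u v" for u v
  proof -
    have "lorentz (L u) (L v) = fst u * fst v
        + (\<alpha>\<^sup>2 - \<beta>\<^sup>2) * (fst (snd u) * fst (snd v) - snd (snd u) * snd (snd v))"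
      unfolding lorentz_coords L_def by (simp add: power2_eq_square algebra_simps)
    then show ?thesis
      unfolding assms lorentz_coords by simp
  qed
  moreover have "(\<lambda>(x, y, z). (x, \<alpha> * y - \<beta> * z, \<alpha> * z - \<beta> * y)) = (\<lambda>v. L v + 0)"
    by (auto simp: L_def)
  ultimately show ?thesis
    unfolding rigid_motion_def by blast
qed

lemma congruent_by_rescaling:
  assumes "open U" "c \<noteq> 0" "rigid_motion \<Phi>"
    and "\<And>s t. (s, t) \<in> U \<Longrightarrow> \<Phi> (X (s, t)) = Y (c * s, t)"
  shows "congruent_to_part_of X U Y"
  unfolding congruent_to_part_of_def
  using assms open_part_of_scaled[of U c "\<Phi> \<circ> X" Y] by auto

lemma congruent_by_translation:
  assumes "open U" and "\<And>s t. (s, t) \<in> U \<Longrightarrow> X (s, t) + d = Y (s, t)"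
  shows "congruent_to_part_of X U Y"
  using congruent_by_rescaling[OF assms(1) _ rigid_motion_translation, of 1 X d Y] assms(2) by simp

section \<open>Straight generating lines\<close>

lemma collinear_profile_line:
  "collinear (profile_curve K [:p0, p1:] [:q0, q1:] ` I)"
proof -
  have "profile_curve K [:p0, p1:] [:q0, q1:] s - profile_curve K [:p0, p1:] [:q0, q1:] t =
      (s - t) *\<^sub>R profile_curve K [:p1:] [:q1:] 0" for s t
    by (cases K) (simp_all add: algebra_simps)
  then show ?thesis
    unfolding collinear_def by blast
qed

text \<open>The image need not be a band between two horizontal circles, since the orbits are helices.  It
  is open because the inverse of the parametrisation exists locally and is continuous: near the point
  with angle \<open>t\<^sub>0\<close> the angle is \<open>t\<^sub>0 + arctan (w / u)\<close>, where \<open>u, w\<close> are the horizontal coordinates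
  rotated by \<open>- t\<^sub>0\<close>, and the parameter \<open>s\<close> is recovered from the height.\<close>
lemma helicoidal_cylinder_open:
  assumes "open I" "r > 0"
  shows "openin (top_of_set (lorentzian_cylinder r))
    ((\<lambda>(s, t). (r * cos t, r * sin t, s + h * t)) ` (I \<times> UNIV))"
    (is "openin _ ?M")
proof (subst openin_subopen, intro ballI)
  fix q assume "q \<in> ?M"
  then obtain s\<^sub>0 t\<^sub>0 where "s\<^sub>0 \<in> I" and q: "q = (r * cos t\<^sub>0, r * sin t\<^sub>0, s\<^sub>0 + h * t\<^sub>0)"
    by auto
  define u where "u = (\<lambda>v :: vec3. fst v * cos t\<^sub>0 + fst (snd v) * sin t\<^sub>0)"
  define w where "w = (\<lambda>v :: vec3. fst (snd v) * cos t\<^sub>0 - fst v * sin t\<^sub>0)"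
  define \<tau> where "\<tau> = (\<lambda>v. t\<^sub>0 + arctan (w v / u v))"
  define B where "B = {v. 0 < u v}"
  define O' where "O' = {v \<in> B. snd (snd v) - h * \<tau> v \<in> I}"
  have "open B"
    unfolding B_def u_def by (intro open_Collect_less continuous_intros)
  moreover have "continuous_on B (\<lambda>v. snd (snd v) - h * \<tau> v)"
    unfolding \<tau>_def w_def u_def B_def by (intro continuous_intros) auto
  ultimately have "open O'"
    using continuous_open_preimage[OF _ _ \<open>open I\<close>] by (auto simp: O'_def vimage_def Int_def)
  have "u q = r * ((cos t\<^sub>0)\<^sup>2 + (sin t\<^sub>0)\<^sup>2)" "w q = 0"
    unfolding u_def w_def q fst_conv snd_conv by algebra+
  then have "q \<in> O'"
    using \<open>r > 0\<close> \<open>s\<^sub>0 \<in> I\<close> by (simp add: O'_def B_def \<tau>_def q)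
  moreover have "q \<in> lorentzian_cylinder r"
    unfolding q lorentzian_cylinder_def
    by (simp add: power_mult_distrib flip: distrib_left)
  moreover have "lorentzian_cylinder r \<inter> O' \<subseteq> ?M"
  proof
    fix v assume v: "v \<in> lorentzian_cylinder r \<inter> O'"
    obtain x y z where xyz: "v = (x, y, z)"
      by (cases v)
    define \<theta> where "\<theta> = arctan (w v / u v)"
    have "u v > 0" and s: "z - h * \<tau> v \<in> I" and circle: "x\<^sup>2 + y\<^sup>2 = r\<^sup>2"
      using v by (auto simp: O'_def B_def xyz lorentzian_cylinder_def)
    have one: "(sin t\<^sub>0)\<^sup>2 + (cos t\<^sub>0)\<^sup>2 = 1"
      by simp
    have "(u v)\<^sup>2 + (w v)\<^sup>2 = r\<^sup>2"
      using circle one unfolding u_def w_def xyz fst_conv snd_conv by algebra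
    then have "1 + (w v / u v)\<^sup>2 = (r / u v)\<^sup>2"
      using \<open>u v > 0\<close> by (simp add: field_simps)
    then have "sqrt (1 + (w v / u v)\<^sup>2) = r / u v"
      using \<open>u v > 0\<close> \<open>r > 0\<close> by simp
    then have "r * cos \<theta> = u v" "r * sin \<theta> = w v"
      using \<open>u v > 0\<close> \<open>r > 0\<close> by (simp_all add: \<theta>_def cos_arctan sin_arctan)
    moreover have "\<tau> v = t\<^sub>0 + \<theta>"
      by (simp add: \<tau>_def \<theta>_def)
    ultimately have "r * cos (\<tau> v) = u v * cos t\<^sub>0 - w v * sin t\<^sub>0"
      "r * sin (\<tau> v) = u v * sin t\<^sub>0 + w v * cos t\<^sub>0"
      by (simp_all add: cos_add sin_add algebra_simps flip: \<open>r * cos \<theta> = u v\<close> \<open>r * sin \<theta> = w v\<close>)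
    moreover have "u v * cos t\<^sub>0 - w v * sin t\<^sub>0 = x" "u v * sin t\<^sub>0 + w v * cos t\<^sub>0 = y"
      using one unfolding u_def w_def xyz fst_conv snd_conv by algebra+
    ultimately have "v = (\<lambda>(s, t). (r * cos t, r * sin t, s + h * t)) (z - h * \<tau> v, \<tau> v)"
      by (simp add: xyz)
    then show "v \<in> ?M"
      using s by blast
  qed
  ultimately show "\<exists>T. openin (top_of_set (lorentzian_cylinder r)) T \<and> q \<in> T \<and> T \<subseteq> ?M"
    using \<open>open O'\<close> by (intro exI[of _ "lorentzian_cylinder r \<inter> O'"]) (auto intro: openin_open_Int)
qed

text \<open>If \<open>a\<^sup>2 \<noteq> 1\<close>, then \<open>D\<close> has degree \<open>2\<close> and \<open>P\<close> at most \<open>2\<close>, and \<open>P = 0\<close> leaves only horizontal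
  lines.  If the line is null, then \<open>D = - h\<^sup>2\<close> and \<open>P = - 2 h\<^sup>2 a\<close> are constant and determine \<open>\<bar>H\<bar>\<close>.\<close>
lemma timelike_graph_line:
  fixes I :: "real set" and a b h H :: real
  defines "X \<equiv> helicoidal_surface Timelike h (profile_curve Timelike [:0, 1:] [:b, a:])"
    and "D \<equiv> gram_poly Timelike h [:0, 1:] [:b, a:]"
    and "P \<equiv> numerator_poly Timelike h [:0, 1:] [:b, a:]"
  assumes "h \<noteq> 0" "open I" "I \<noteq> {}"
    and eq: "\<And>s. s \<in> I \<Longrightarrow> 4 * H\<^sup>2 * \<bar>poly D s\<bar> ^ 3 = (poly P s)\<^sup>2"
  shows "(H = 0 \<and> congruent_to_part_of X (I \<times> UNIV) (helicoid1 h)) \<or>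
    (\<bar>H\<bar> = 1 / \<bar>h\<bar> \<and>
      (\<exists>\<sigma>\<in>{1, -1}. \<exists>a\<^sub>0. congruent_to_part_of X (I \<times> UNIV) (null_line_surface_timelike h \<sigma> a\<^sub>0)))"
proof -
  have U: "open (I \<times> (UNIV :: real set))"
    using \<open>open I\<close> by (simp add: open_Times)
  have D: "D = [:- h\<^sup>2, 0, 1 - a\<^sup>2:]" and P: "P = [:- 2 * h\<^sup>2 * a, 0, a * (1 - a\<^sup>2):]"
    by (simp_all add: D_def P_def pderiv_pCons power2_eq_square algebra_simps)
  show ?thesis
  proof (cases "a\<^sup>2 = 1")
    case True
    then have a: "a \<in> {1, -1}"
      by (simp add: power2_eq_1_iff)
    obtain s where "s \<in> I"
      using \<open>I \<noteq> {}\<close> by blast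
    from eq[OF this] have "4 * H\<^sup>2 * (h\<^sup>2) ^ 3 = (2 * h\<^sup>2 * a)\<^sup>2"
      by (simp add: D P True)
    then have "(H\<^sup>2 * h\<^sup>2) * (4 * h ^ 4) = 1 * (4 * h ^ 4)"
      using True
      by (simp add: power_mult_distrib power2_eq_square power3_eq_cube power4_eq_xxxx mult.assoc)
    then have "H\<^sup>2 * h\<^sup>2 = 1"
      using \<open>h \<noteq> 0\<close> by (metis mult_cancel_right power_not_zero mult_eq_0_iff zero_neq_numeral)
    then have "(\<bar>H\<bar> * \<bar>h\<bar>)\<^sup>2 = 1\<^sup>2"
      by (simp add: power_mult_distrib)
    then have "\<bar>H\<bar> * \<bar>h\<bar> = 1"
      by (simp only: power2_eq_iff_nonneg zero_le_mult_iff abs_ge_zero zero_le_one simp_thms)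
    then have "\<bar>H\<bar> = 1 / \<bar>h\<bar>"
      using \<open>h \<noteq> 0\<close> by (simp add: field_simps)
    moreover have "congruent_to_part_of X (I \<times> UNIV) (null_line_surface_timelike h a b)"
      by (rule congruent_by_translation[OF U, of _ 0])
        (simp add: X_def helicoidal_surface_def zero_prod_def algebra_simps)
    ultimately show ?thesis
      using a by blast
  next
    case False
    then have "2 * degree P < 3 * degree D"
      by (simp add: D P)
    then have "H = 0 \<and> P = 0"
      using growth_forces_minimal[OF \<open>open I\<close> \<open>I \<noteq> {}\<close> eq] by blast
    then have "H = 0" "a = 0"
      using \<open>h \<noteq> 0\<close> by (simp_all add: P)
    moreover have "congruent_to_part_of X (I \<times> UNIV) (helicoid1 h)"
      by (rule congruent_by_translation[OF U, of _ "(0, 0, - b)"])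
        (simp add: X_def helicoidal_surface_def \<open>a = 0\<close>)
    ultimately show ?thesis by blast
  qed
qed

text \<open>The numerator and the Gram determinant are the constant \<open>- r\<^sup>2\<close>.\<close>
lemma timelike_vertical_line:
  fixes I :: "real set" and r h H :: real
  defines "X \<equiv> helicoidal_surface Timelike h (profile_curve Timelike [:r:] [:0, 1:])"
    and "D \<equiv> gram_poly Timelike h [:r:] [:0, 1:]"
    and "P \<equiv> numerator_poly Timelike h [:r:] [:0, 1:]"
  assumes "r > 0" "open I" "s \<in> I"
    and eq: "4 * H\<^sup>2 * \<bar>poly D s\<bar> ^ 3 = (poly P s)\<^sup>2"
  shows "\<bar>H\<bar> = 1 / (2 * r) \<and> congruent_to_part_of_set X (I \<times> UNIV) (lorentzian_cylinder r)"
proof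
  have D: "D = [:- r\<^sup>2:]" and P: "P = [:- r\<^sup>2:]"
    by (simp_all add: D_def P_def pderiv_pCons power2_eq_square)
  have "(2 * H * r)\<^sup>2 * r ^ 4 = 4 * H\<^sup>2 * (r\<^sup>2) ^ 3"
    by (simp add: power_mult_distrib flip: power_mult power_add)
  also have "\<dots> = 1 * r ^ 4"
    using eq by (simp add: D P flip: power_mult)
  finally have "(2 * H * r)\<^sup>2 * r ^ 4 = 1 * r ^ 4" .
  then have "(2 * H * r)\<^sup>2 = 1"
    using \<open>r > 0\<close> by simp
  then have "2 * \<bar>H\<bar> * r = 1"
    using \<open>r > 0\<close> by (simp add: abs_square_eq_1 abs_mult)
  then show "\<bar>H\<bar> = 1 / (2 * r)"
    using \<open>r > 0\<close> by (simp add: field_simps)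
  have "X = (\<lambda>(s, t). (r * cos t, r * sin t, s + h * t))"
    by (auto simp: X_def helicoidal_surface_def)
  then show "congruent_to_part_of_set X (I \<times> UNIV) (lorentzian_cylinder r)"
    using helicoidal_cylinder_open[OF \<open>open I\<close> \<open>r > 0\<close>, of h] rigid_motion_translation[of 0]
    unfolding congruent_to_part_of_set_def by (intro exI[of _ "\<lambda>x. x + 0"]) (simp add: comp_def)
qed

text \<open>If the line is null, then \<open>D = - b\<^sup>2\<close> and \<open>P = 0\<close>, so that non-degeneracy gives \<open>b \<noteq> 0\<close>.  Otherwise
  the comparison of degrees gives \<open>b = 0\<close>, and an isometry fixing the axis moves the line
  to the \<open>y\<close>-axis if it is spacelike and to the \<open>z\<close>-axis if it is timelike.\<close>
lemma spacelike_graph_line: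
  fixes I :: "real set" and a b h H :: real
  defines "X \<equiv> helicoidal_surface Spacelike h (profile_curve Spacelike [:0, 1:] [:b, a:])"
    and "D \<equiv> gram_poly Spacelike h [:0, 1:] [:b, a:]"
    and "P \<equiv> numerator_poly Spacelike h [:0, 1:] [:b, a:]"
  assumes "h \<noteq> 0" "open I" "I \<noteq> {}"
    and nondeg: "\<And>s. s \<in> I \<Longrightarrow> poly D s \<noteq> 0"
    and eq: "\<And>s. s \<in> I \<Longrightarrow> 4 * H\<^sup>2 * \<bar>poly D s\<bar> ^ 3 = (poly P s)\<^sup>2"
  shows "H = 0 \<and>
    (congruent_to_part_of X (I \<times> UNIV) (helicoid2 h) \<or>
     congruent_to_part_of X (I \<times> UNIV) (helicoid3 h) \<or>
     (\<exists>\<sigma>\<in>{1, -1}. \<exists>a\<^sub>0. a\<^sub>0 \<noteq> 0 \<and>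
        congruent_to_part_of X (I \<times> UNIV) (null_line_surface_spacelike h \<sigma> a\<^sub>0)))"
proof -
  have U: "open (I \<times> (UNIV :: real set))"
    using \<open>open I\<close> by (simp add: open_Times)
  define k where "k = 1 - a\<^sup>2"
  have D: "D = [:h\<^sup>2 * k - (a * b)\<^sup>2, 2 * a * b * k, - k\<^sup>2:]" and P: "P = [:h * b * k:]"
    by (simp_all add: D_def P_def k_def pderiv_pCons power2_eq_square algebra_simps)
  have X: "X (s, t) = (h * t, s * cosh t + (b + a * s) * sinh t, s * sinh t + (b + a * s) * cosh t)"
    for s t
    by (simp add: X_def helicoidal_surface_def algebra_simps)
  show ?thesis
  proof (cases "k = 0")
    case True
    then have a: "a \<in> {1, -1}"
      by (simp add: k_def power2_eq_1_iff)
    obtain s where "s \<in> I"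
      using \<open>I \<noteq> {}\<close> by blast
    have "b \<noteq> 0" "H = 0"
      using nondeg[OF \<open>s \<in> I\<close>] eq[OF \<open>s \<in> I\<close>] by (auto simp: D P True)
    moreover have "congruent_to_part_of X (I \<times> UNIV) (null_line_surface_spacelike h a b)"
      by (rule congruent_by_translation[OF U, of _ 0]) (simp add: X zero_prod_def algebra_simps)
    ultimately show ?thesis
      using a by blast
  next
    case False
    then have "2 * degree P < 3 * degree D"
      by (simp add: D P)
    then have "H = 0 \<and> P = 0"
      using growth_forces_minimal[OF \<open>open I\<close> \<open>I \<noteq> {}\<close> eq] by blast
    then have "H = 0" "b = 0"
      using \<open>h \<noteq> 0\<close> False by (simp_all add: P)
    show ?thesis
    proof (cases "k > 0")
      case True
      define c where "c = sqrt k"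
      have c: "c \<noteq> 0" "c\<^sup>2 = 1 - a\<^sup>2"
        using True by (simp_all add: c_def k_def)
      \<comment> \<open>The unit direction of the line is \<open>(1 / c, a / c)\<close>; the isometry maps it to \<open>(1, 0)\<close>.\<close>
      have "(1 / c)\<^sup>2 - (a / c)\<^sup>2 = (1 - a\<^sup>2) / c\<^sup>2"
        by (simp add: power_divide diff_divide_distrib)
      then have "(1 / c)\<^sup>2 - (a / c)\<^sup>2 = 1"
        unfolding c(2)[symmetric] using c(1) by simp
      note boost = rigid_motion_boost[OF this]
      have "congruent_to_part_of X (I \<times> UNIV) (helicoid2 h)"
      proof (rule congruent_by_rescaling[OF U \<open>c \<noteq> 0\<close> boost])
        fix s t
        have "1 / c * u - a / c * (a * u) = (1 - a\<^sup>2) / c * u" for u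
          by (simp add: diff_divide_distrib left_diff_distrib power2_eq_square)
        then have "1 / c * u - a / c * (a * u) = c * u" for u
          unfolding c(2)[symmetric] by (simp add: power2_eq_square)
        from this[of "s * cosh t"] this[of "s * sinh t"]
        show "(case X (s, t) of (x, y, z) \<Rightarrow> (x, 1 / c * y - a / c * z, 1 / c * z - a / c * y)) =
            helicoid2 h (c * s, t)"
          by (simp add: X \<open>b = 0\<close> add_divide_distrib algebra_simps)
      qed
      with \<open>H = 0\<close> show ?thesis by blast
    next
      case False
      define c where "c = sqrt (- k)"
      have c: "c \<noteq> 0" "c\<^sup>2 = a\<^sup>2 - 1"
        using False \<open>k \<noteq> 0\<close> by (simp_all add: c_def k_def)
      \<comment> \<open>The unit direction of the line is \<open>(1 / c, a / c)\<close>; the isometry maps it to \<open>(0, 1)\<close>.\<close>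
      have "(a / c)\<^sup>2 - (1 / c)\<^sup>2 = (a\<^sup>2 - 1) / c\<^sup>2"
        by (simp add: power_divide diff_divide_distrib)
      then have "(a / c)\<^sup>2 - (1 / c)\<^sup>2 = 1"
        unfolding c(2)[symmetric] using c(1) by simp
      note boost = rigid_motion_boost[OF this]
      have "congruent_to_part_of X (I \<times> UNIV) (helicoid3 h)"
      proof (rule congruent_by_rescaling[OF U \<open>c \<noteq> 0\<close> boost])
        fix s t
        have "a / c * (a * u) - 1 / c * u = (a\<^sup>2 - 1) / c * u" for u
          by (simp add: diff_divide_distrib left_diff_distrib power2_eq_square)
        then have "a / c * (a * u) - 1 / c * u = c * u" for u
          unfolding c(2)[symmetric] by (simp add: power2_eq_square)
        from this[of "s * cosh t"] this[of "s * sinh t"]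
        show "(case X (s, t) of (x, y, z) \<Rightarrow> (x, a / c * y - 1 / c * z, a / c * z - 1 / c * y)) =
            helicoid3 h (c * s, t)"
          by (simp add: X \<open>b = 0\<close> add_divide_distrib algebra_simps)
      qed
      with \<open>H = 0\<close> show ?thesis by blast
    qed
  qed
qed

text \<open>Here \<open>D = - h\<^sup>2 - s\<^sup>2\<close> and \<open>P = h b\<close>, so that the line must meet the axis.\<close>
lemma spacelike_vertical_line:
  fixes I :: "real set" and b h H :: real
  defines "X \<equiv> helicoidal_surface Spacelike h (profile_curve Spacelike [:b:] [:0, 1:])"
    and "D \<equiv> gram_poly Spacelike h [:b:] [:0, 1:]"
    and "P \<equiv> numerator_poly Spacelike h [:b:] [:0, 1:]"
  assumes "h \<noteq> 0" "open I" "I \<noteq> {}"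
    and eq: "\<And>s. s \<in> I \<Longrightarrow> 4 * H\<^sup>2 * \<bar>poly D s\<bar> ^ 3 = (poly P s)\<^sup>2"
  shows "H = 0 \<and> congruent_to_part_of X (I \<times> UNIV) (helicoid3 h)"
proof -
  have D: "D = [:- h\<^sup>2, 0, - 1:]" and P: "P = [:h * b:]"
    by (simp_all add: D_def P_def pderiv_pCons power2_eq_square algebra_simps)
  have "2 * degree P < 3 * degree D"
    by (simp add: D P)
  then have "H = 0 \<and> P = 0"
    using growth_forces_minimal[OF \<open>open I\<close> \<open>I \<noteq> {}\<close> eq] by blast
  then have "H = 0" "b = 0"
    using \<open>h \<noteq> 0\<close> by (simp_all add: P)
  moreover have "congruent_to_part_of X (I \<times> UNIV) (helicoid3 h)"
    using \<open>open I\<close>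
    by (intro congruent_by_translation[of _ _ 0])
      (simp_all add: X_def helicoidal_surface_def open_Times \<open>b = 0\<close> zero_prod_def)
  ultimately show ?thesis by blast
qed

text \<open>\<open>D\<close> has degree \<open>1\<close> and \<open>P = 4 h\<^sup>2 a\<close> is constant, so the line is parallel to the \<open>y\<close>-axis and the
  remaining constant \<open>b\<close> is removed by a translation along the axis.\<close>
lemma lightlike_graph_line:
  fixes I :: "real set" and a b h H :: real
  defines "X \<equiv> helicoidal_surface Lightlike h (profile_curve Lightlike [:0, 1:] [:b, a:])"
    and "D \<equiv> gram_poly Lightlike h [:0, 1:] [:b, a:]"
    and "P \<equiv> numerator_poly Lightlike h [:0, 1:] [:b, a:]"
  assumes "h \<noteq> 0" "open I" "I \<noteq> {}"
    and eq: "\<And>s. s \<in> I \<Longrightarrow> 4 * H\<^sup>2 * \<bar>poly D s\<bar> ^ 3 = (poly P s)\<^sup>2"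
  shows "H = 0 \<and> congruent_to_part_of X (I \<times> UNIV) (cayley_surface h)"
proof -
  have D: "D = [:- 4 * h\<^sup>2 * a\<^sup>2, - 4 * h:]" and P: "P = [:4 * h\<^sup>2 * a:]"
    by (simp_all add: D_def P_def pderiv_pCons power2_eq_square algebra_simps)
  have "2 * degree P < 3 * degree D"
    using \<open>h \<noteq> 0\<close> by (simp add: D P)
  then have "H = 0 \<and> P = 0"
    using growth_forces_minimal[OF \<open>open I\<close> \<open>I \<noteq> {}\<close> eq] by blast
  then have "H = 0" "a = 0"
    using \<open>h \<noteq> 0\<close> by (simp_all add: P)
  moreover have "congruent_to_part_of X (I \<times> UNIV) (cayley_surface h)"
    using \<open>open I\<close>
    by (intro congruent_by_translation[of _ _ "(- b, 0, - b)"])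
      (simp_all add: X_def helicoidal_surface_def open_Times \<open>a = 0\<close> algebra_simps)
  ultimately show ?thesis by blast
qed

text \<open>The line is parallel to the axis, \<open>P = 0\<close>, and \<open>D = - 4 h\<^sup>2\<close> does not vanish.\<close>
lemma lightlike_vertical_line:
  fixes I :: "real set" and b h H :: real
  defines "X \<equiv> helicoidal_surface Lightlike h (profile_curve Lightlike [:b:] [:0, 1:])"
    and "D \<equiv> gram_poly Lightlike h [:b:] [:0, 1:]"
    and "P \<equiv> numerator_poly Lightlike h [:b:] [:0, 1:]"
  assumes "h \<noteq> 0" "open I" "s \<in> I"
    and eq: "4 * H\<^sup>2 * \<bar>poly D s\<bar> ^ 3 = (poly P s)\<^sup>2"
  shows "H = 0 \<and> congruent_to_part_of X (I \<times> UNIV) (parabolic_null_cylinder h b)"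
proof
  have D: "D = [:- 4 * h\<^sup>2:]" and P: "P = 0"
    by (simp_all add: D_def P_def pderiv_pCons power2_eq_square)
  show "H = 0"
    using eq \<open>h \<noteq> 0\<close> by (simp add: D P)
  show "congruent_to_part_of X (I \<times> UNIV) (parabolic_null_cylinder h b)"
    using \<open>open I\<close>
    by (intro congruent_by_translation[of _ _ 0])
      (simp_all add: X_def helicoidal_surface_def open_Times zero_prod_def algebra_simps)
qed

section \<open>The classification\<close>

theorem theorem1p1:
  fixes K :: axis and h H :: real and m :: nat and I :: "real set"
    and \<gamma> :: "real \<Rightarrow> vec3" and X N :: "real \<times> real \<Rightarrow> vec3" and U :: "(real \<times> real) set"
  defines "X \<equiv> helicoidal_surface K h \<gamma>" and "U \<equiv> I \<times> (UNIV :: real set)"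
  assumes "h \<noteq> 0"
    and "open I" and "is_interval I" and "I \<noteq> {}"
    and "generating_curve K m \<gamma>"
    and "nondegenerate_surface X U"
    and "unit_normal_field X U N"
    and "\<forall>p\<in>U. has_mean_curvature_at X N p H"
  shows "m \<le> 1 \<and> collinear (\<gamma> ` I) \<and>
    (K = Timelike \<longrightarrow>
        (H = 0 \<and> congruent_to_part_of X U (helicoid1 h)) \<or>
        (\<bar>H\<bar> = 1 / \<bar>h\<bar> \<and>
          (\<exists>\<sigma>\<in>{1, -1}. \<exists>a\<^sub>0. congruent_to_part_of X U (null_line_surface_timelike h \<sigma> a\<^sub>0))) \<or>
        (\<exists>r>0. \<bar>H\<bar> = 1 / (2 * r) \<and> congruent_to_part_of_set X U (lorentzian_cylinder r))) \<and>
    (K = Spacelike \<longrightarrow>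
        H = 0 \<and>
        (congruent_to_part_of X U (helicoid2 h) \<or>
         congruent_to_part_of X U (helicoid3 h) \<or>
         (\<exists>\<sigma>\<in>{1, -1}. \<exists>a\<^sub>0. a\<^sub>0 \<noteq> 0 \<and>
            congruent_to_part_of X U (null_line_surface_spacelike h \<sigma> a\<^sub>0)))) \<and>
    (K = Lightlike \<longrightarrow>
        H = 0 \<and>
        (congruent_to_part_of X U (cayley_surface h) \<or>
         (\<exists>b. congruent_to_part_of X U (parabolic_null_cylinder h b))))"
proof -
  obtain s\<^sub>0 where "s\<^sub>0 \<in> I"
    using \<open>I \<noteq> {}\<close> by blast
  have curvature: "poly (gram_poly K h p q) s \<noteq> 0 \<and>
      4 * H\<^sup>2 * \<bar>poly (gram_poly K h p q) s\<bar> ^ 3 = (poly (numerator_poly K h p q) s)\<^sup>2"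
    if "\<gamma> = profile_curve K p q" "s \<in> I" for p q s
    using helicoidal_curvature[OF \<open>open I\<close> \<open>s \<in> I\<close>, of K h p q N H]
      \<open>nondegenerate_surface X U\<close> \<open>unit_normal_field X U N\<close>
      \<open>\<forall>p\<in>U. has_mean_curvature_at X N p H\<close>
    unfolding X_def U_def \<open>\<gamma> = profile_curve K p q\<close> by blast
  from \<open>generating_curve K m \<gamma>\<close> show ?thesis
  proof cases
    case (graph f)
    have \<gamma>: "\<gamma> = profile_curve K [:0, 1:] f"
    proof
      show "\<gamma> s = profile_curve K [:0, 1:] f s" for s
        unfolding graph by (cases K) simp_all
    qed
    note curv = curvature[OF \<gamma>]
    have "degree f \<le> 1"
    proof (rule ccontr)
      assume "\<not> degree f \<le> 1"
      then have "2 * degree (numerator_poly K h [:0, 1:] f) < 3 * degree (gram_poly K h [:0, 1:] f)"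
        "numerator_poly K h [:0, 1:] f \<noteq> 0"
        using degrees_of_nonlinear_graph[OF \<open>h \<noteq> 0\<close>, of f K] by simp_all
      then show False
        using growth_forces_minimal[OF \<open>open I\<close> \<open>I \<noteq> {}\<close>] curv by blast
    qed
    then have "coeff f n = coeff [:coeff f 0, coeff f 1:] n" for n
      by (cases "n \<le> 1") (auto simp: coeff_eq_0 coeff_pCons le_Suc_eq split: nat.split)
    then have "f = [:coeff f 0, coeff f 1:]"
      by (rule poly_eqI)
    then obtain a b where f: "f = [:b, a:]"
      by (rule that)
    have line: "m \<le> 1" "collinear (\<gamma> ` I)"
      using \<open>m = degree f\<close> \<open>degree f \<le> 1\<close> collinear_profile_line[of K 0 1 b a I]
      unfolding \<gamma> f by simp_all
    note X = X_def[unfolded \<gamma> f]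
    note nondeg = conjunct1[OF curv[unfolded f]] and eq = conjunct2[OF curv[unfolded f]]
    show ?thesis
    proof (cases K)
      case Timelike
      show ?thesis
        using timelike_graph_line[OF \<open>h \<noteq> 0\<close> \<open>open I\<close> \<open>I \<noteq> {}\<close> eq[unfolded Timelike]] line Timelike
        unfolding X[unfolded Timelike, symmetric] U_def[symmetric] by simp blast
    next
      case Spacelike
      show ?thesis
        using spacelike_graph_line[OF \<open>h \<noteq> 0\<close> \<open>open I\<close> \<open>I \<noteq> {}\<close> nondeg[unfolded Spacelike]
            eq[unfolded Spacelike]] line Spacelike
        unfolding X[unfolded Spacelike, symmetric] U_def[symmetric] by simp
    next
      case Lightlike
      show ?thesis
        using lightlike_graph_line[OF \<open>h \<noteq> 0\<close> \<open>open I\<close> \<open>I \<noteq> {}\<close> eq[unfolded Lightlike]] line Lightlike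
        unfolding X[unfolded Lightlike, symmetric] U_def[symmetric] by simp
    qed
  next
    case (line_timelike r)
    have \<gamma>: "\<gamma> = profile_curve Timelike [:r:] [:0, 1:]"
      unfolding line_timelike by auto
    have line: "collinear (\<gamma> ` I)"
      using collinear_profile_line[of Timelike r 0 0 1 I] unfolding \<gamma> by simp
    show ?thesis
      using timelike_vertical_line[OF \<open>r > 0\<close> \<open>open I\<close> \<open>s\<^sub>0 \<in> I\<close>
          conjunct2[OF curvature[unfolded \<open>K = Timelike\<close>, OF \<gamma> \<open>s\<^sub>0 \<in> I\<close>]]]
        line \<open>m = 1\<close> \<open>K = Timelike\<close> \<open>r > 0\<close>
      unfolding X_def[unfolded \<gamma> \<open>K = Timelike\<close>, symmetric] U_def[symmetric] by auto
  next
    case (line_spacelike b)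
    have \<gamma>: "\<gamma> = profile_curve Spacelike [:b:] [:0, 1:]"
      unfolding line_spacelike by auto
    have line: "collinear (\<gamma> ` I)"
      using collinear_profile_line[of Spacelike b 0 0 1 I] unfolding \<gamma> by simp
    show ?thesis
      using spacelike_vertical_line[OF \<open>h \<noteq> 0\<close> \<open>open I\<close> \<open>I \<noteq> {}\<close>
          conjunct2[OF curvature[unfolded \<open>K = Spacelike\<close>, OF \<gamma>]]]
        line \<open>m = 1\<close> \<open>K = Spacelike\<close>
      unfolding X_def[unfolded \<gamma> \<open>K = Spacelike\<close>, symmetric] U_def[symmetric] by simp
  next
    case (line_lightlike b)
    have \<gamma>: "\<gamma> = profile_curve Lightlike [:b:] [:0, 1:]"
      unfolding line_lightlike by auto
    have line: "collinear (\<gamma> ` I)"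
      using collinear_profile_line[of Lightlike b 0 0 1 I] unfolding \<gamma> by simp
    show ?thesis
      using lightlike_vertical_line[OF \<open>h \<noteq> 0\<close> \<open>open I\<close> \<open>s\<^sub>0 \<in> I\<close>
          conjunct2[OF curvature[unfolded \<open>K = Lightlike\<close>, OF \<gamma> \<open>s\<^sub>0 \<in> I\<close>]]]
        line \<open>m = 1\<close> \<open>K = Lightlike\<close>
      unfolding X_def[unfolded \<gamma> \<open>K = Lightlike\<close>, symmetric] U_def[symmetric] by auto
  qed
qed

end
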